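(* For each integer $m\geq 1$, there exists a 2-connected pseudo-outerplanar graph $G$ of order $10m+5$ with $\Delta(G)=4$ and $la(G)=\lceil\Delta(G)/2\rceil+1=3$.
   Context: All graphs are finite, simple and undirected. A block is a maximal 2-connected subgraph. A graph is pseudo-outerplanar if each of its blocks can be drawn in the plane so that its vertices lie on a fixed circle, its edges lie inside the disk bounded by that circle, and each edge crosses at most one other edge. $\Delta(G)$ is the maximum degree. The linear arboricity $la(G)$ is the minimum number of linear forests (forests whose components are paths) into which $E(G)$ can be partitioned. *)

theory Defs
  imports "HOL-Analysis.Analysis" "HOL-Library.Disjoint_Sets"
begin

section \<open>Finite simple undirected graphs\<close>

text \<open>A graph is a pair of a vertex set and a set of two-element edges.\<close>

type_synonym 'a graph = "'a set \<times> 'a set set"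

abbreviation verts :: "'a graph \<Rightarrow> 'a set" where "verts G \<equiv> fst G"
abbreviation edges :: "'a graph \<Rightarrow> 'a set set" where "edges G \<equiv> snd G"

definition simple_graph :: "'a graph \<Rightarrow> bool" where
  "simple_graph G \<longleftrightarrow> finite (verts G) \<and> (\<forall>e\<in>edges G. e \<subseteq> verts G \<and> card e = 2)"

definition subgraph :: "'a graph \<Rightarrow> 'a graph \<Rightarrow> bool" where
  "subgraph H G \<longleftrightarrow> simple_graph H \<and> verts H \<subseteq> verts G \<and> edges H \<subseteq> edges G"

text \<open>\<open>H\<close> is a maximal subgraph of \<open>G\<close> with property \<open>P\<close>.\<close>

definition maximal_subgraph :: "('a graph \<Rightarrow> bool) \<Rightarrow> 'a graph \<Rightarrow> 'a graph \<Rightarrow> bool" where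
  "maximal_subgraph P H G \<longleftrightarrow>
     subgraph H G \<and> P H \<and> (\<forall>K. subgraph K G \<and> P K \<and> subgraph H K \<longrightarrow> K = H)"

definition degree :: "'a graph \<Rightarrow> 'a \<Rightarrow> nat" where
  "degree G v = card {e \<in> edges G. v \<in> e}"

definition max_degree :: "'a graph \<Rightarrow> nat" where
  "max_degree G = Max (degree G ` verts G)"

definition delete_verts :: "'a graph \<Rightarrow> 'a set \<Rightarrow> 'a graph" where
  "delete_verts G X = (verts G - X, {e \<in> edges G. e \<inter> X = {}})"

definition connected_graph :: "'a graph \<Rightarrow> bool" where
  "connected_graph G \<longleftrightarrow> verts G \<noteq> {} \<and>
     (\<forall>u\<in>verts G. \<forall>v\<in>verts G. (u, v) \<in> {(x, y). {x, y} \<in> edges G}\<^sup>*)"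

definition k_connected :: "nat \<Rightarrow> 'a graph \<Rightarrow> bool" where
  "k_connected k G \<longleftrightarrow> card (verts G) > k \<and>
     (\<forall>X \<subseteq> verts G. card X < k \<longrightarrow> connected_graph (delete_verts G X))"

text \<open>
  A 2-connected graph has at least three vertices here, so bridges and isolated vertices
  are not blocks. This does not affect pseudo-outerplanarity below: graphs with at most
  two vertices can always be drawn as required.
\<close>

definition block :: "'a graph \<Rightarrow> 'a graph \<Rightarrow> bool" where
  "block H G \<longleftrightarrow> maximal_subgraph (k_connected 2) H G"


section \<open>Linear arboricity\<close>

definition walk_edges :: "'a list \<Rightarrow> 'a set set" where
  "walk_edges xs = {{xs ! i, xs ! Suc i} | i. Suc i < length xs}"

definition path_graph :: "'a graph \<Rightarrow> bool" where
  "path_graph G \<longleftrightarrow>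
     (\<exists>xs. xs \<noteq> [] \<and> distinct xs \<and> verts G = set xs \<and> edges G = walk_edges xs)"

definition cycle_graph :: "'a graph \<Rightarrow> bool" where
  "cycle_graph G \<longleftrightarrow>
     (\<exists>xs. length xs \<ge> 3 \<and> distinct xs \<and> verts G = set xs \<and>
           edges G = insert {last xs, hd xs} (walk_edges xs))"

definition forest :: "'a graph \<Rightarrow> bool" where
  "forest G \<longleftrightarrow> simple_graph G \<and> \<not> (\<exists>C. subgraph C G \<and> cycle_graph C)"

text \<open>A single vertex is a (trivial) path, so isolated vertices are allowed.\<close>

definition linear_forest :: "'a graph \<Rightarrow> bool" where
  "linear_forest G \<longleftrightarrow>
     forest G \<and> (\<forall>C. maximal_subgraph connected_graph C G \<longrightarrow> path_graph C)"

text \<open>Each part \<open>F\<close> of the edge set is viewed as a spanning subgraph.\<close>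

definition linear_arboricity :: "'a graph \<Rightarrow> nat" where
  "linear_arboricity G =
     (LEAST k. \<exists>P. partition_on (edges G) P \<and> card P = k \<and>
                   (\<forall>F\<in>P. linear_forest (verts G, F)))"


section \<open>Pseudo-outerplanar graphs\<close>

text \<open>
  The plane is identified with the complex numbers. The vertex \<open>v\<close> is drawn as the
  point \<open>p v\<close> on the circle with centre \<open>c\<close> and radius \<open>r\<close>, and the edge \<open>e\<close> as the
  simple arc \<open>\<gamma> e\<close> in the closed disk. As usual for drawings, an arc passes through no
  vertices other than its ends.
\<close>

definition disk_drawing ::
    "'a graph \<Rightarrow> complex \<Rightarrow> real \<Rightarrow> ('a \<Rightarrow> complex) \<Rightarrow> ('a set \<Rightarrow> real \<Rightarrow> complex) \<Rightarrow> bool" where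
  "disk_drawing G c r p \<gamma> \<longleftrightarrow>
     r > 0 \<and> inj_on p (verts G) \<and> p ` verts G \<subseteq> sphere c r \<and>
     (\<forall>e\<in>edges G. arc (\<gamma> e) \<and> {pathstart (\<gamma> e), pathfinish (\<gamma> e)} = p ` e \<and>
        path_image (\<gamma> e) \<subseteq> cball c r \<and> path_image (\<gamma> e) \<inter> p ` verts G = p ` e)"

text \<open>
  Two distinct edges cross if they meet in any point other than a common end; touching
  and overlapping thus also count as crossing.
\<close>

definition edges_cross ::
    "('a \<Rightarrow> complex) \<Rightarrow> ('a set \<Rightarrow> real \<Rightarrow> complex) \<Rightarrow> 'a set \<Rightarrow> 'a set \<Rightarrow> bool" where
  "edges_cross p \<gamma> e f \<longleftrightarrow>
     e \<noteq> f \<and> \<not> path_image (\<gamma> e) \<inter> path_image (\<gamma> f) \<subseteq> p ` (e \<inter> f)"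

definition pseudo_outerplanar :: "'a graph \<Rightarrow> bool" where
  "pseudo_outerplanar G \<longleftrightarrow>
     (\<forall>H. block H G \<longrightarrow>
        (\<exists>c r p \<gamma>. disk_drawing H c r p \<gamma> \<and>
           (\<forall>e\<in>edges H. card {f \<in> edges H. edges_cross p \<gamma> e f} \<le> 1)))"

end

(*
  Place five vertices u, w, t, x, v in this order on an arc of the circle, join consecutive
  ones, and add the four chords ux, wv, wx, uv: a K4 on u, w, x, v whose edge wx carries the
  triangle wtx. Link an odd number L = 2m + 1 of such gadgets into a ring by joining v of each
  gadget to u of the next one. Only ux and wv cross, the outer circle is a Hamiltonian cycle,
  and all degrees are at most 4.

  Suppose the edges are covered by two linear forests. A gadget has 8 edges on 5 vertices, so
  both forests restrict to Hamiltonian paths of it, both of which end in t, which has degree 2.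
  As w and x have degree 4, the two other ends are u and v, one for each path, so the links
  leaving the gadget at u and at v have different colours. The colours of the links thus
  alternate around the ring, which is impossible for odd L.
*)
theory Submission
  imports Defs
begin

subsection \<open>Linear forests\<close>

lemma walk_edges_single [simp]: "walk_edges [x] = {}"
  by (auto simp: walk_edges_def)

lemma walk_edges_Cons [simp]: "walk_edges (x # y # zs) = insert {x, y} (walk_edges (y # zs))"
proof (intro equalityI subsetI)
  fix e assume "e \<in> walk_edges (x # y # zs)"
  then obtain i where "Suc i < length (x # y # zs)"
      "e = {(x # y # zs) ! i, (x # y # zs) ! Suc i}"
    unfolding walk_edges_def by blast
  then show "e \<in> insert {x, y} (walk_edges (y # zs))"
    by (cases i) (auto simp: walk_edges_def)
next
  fix e assume "e \<in> insert {x, y} (walk_edges (y # zs))"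
  then consider "e = {x, y}"
    | i where "Suc i < length (y # zs)" "e = {(y # zs) ! i, (y # zs) ! Suc i}"
    unfolding walk_edges_def by blast
  then show "e \<in> walk_edges (x # y # zs)"
  proof cases
    case 1
    then show ?thesis by (auto simp: walk_edges_def intro!: exI[of _ 0])
  next
    case 2
    then show ?thesis by (auto simp: walk_edges_def intro!: exI[of _ "Suc i"])
  qed
qed

lemma forest_no_cycle:
  assumes "forest (V, F)" "length xs \<ge> 3" "distinct xs"
  shows "\<not> insert {last xs, hd xs} (walk_edges xs) \<subseteq> F"
proof
  assume sub: "insert {last xs, hd xs} (walk_edges xs) \<subseteq> F"
  let ?C = "(set xs, insert {last xs, hd xs} (walk_edges xs))"
  have sF: "\<And>e. e \<in> F \<Longrightarrow> e \<subseteq> V \<and> card e = 2"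
    using assms(1) by (auto simp: forest_def simple_graph_def)
  have ne: "xs \<noteq> []" using assms(2) by auto
  have inC: "\<And>e. e \<in> edges ?C \<Longrightarrow> e \<subseteq> set xs"
    using ne by (auto simp: walk_edges_def)
  have "set xs \<subseteq> V"
  proof
    fix x assume "x \<in> set xs"
    then obtain i where i: "i < length xs" "x = xs ! i" by (auto simp: in_set_conv_nth)
    show "x \<in> V"
    proof (cases "Suc i < length xs")
      case True
      then have "{xs ! i, xs ! Suc i} \<in> F" using sub by (auto simp: walk_edges_def)
      then show ?thesis using sF i by blast
    next
      case False
      then have "i = length xs - 1" using i by simp
      then have "x = last xs" using i ne by (simp add: last_conv_nth)
      then show ?thesis using sub sF by blast
    qed
  qed
  then have "subgraph ?C (V, F)"
    using sub sF inC by (auto simp: subgraph_def simple_graph_def)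
  moreover have "cycle_graph ?C" using assms by (auto simp: cycle_graph_def)
  ultimately show False using assms(1) by (auto simp: forest_def)
qed

text \<open>A walk in \<open>F\<close> from \<open>v\<close> never leaves the reachability class
  \<open>W\<close>, so all its edges are induced on \<open>W\<close>; and a connected subgraph
  containing \<open>v\<close> has only vertices reachable from \<open>v\<close>. This supplies the
  concrete component to which the path condition of \<open>linear_forest\<close> is applied.\<close>

lemma component_is_maximal:
  assumes "simple_graph (V, F)" "v \<in> V"
  defines "W \<equiv> {w. (v, w) \<in> {(x, y). {x, y} \<in> F}\<^sup>*}"
  shows "maximal_subgraph connected_graph (W, {e \<in> F. e \<subseteq> W}) (V, F)"
proof -
  let ?R = "{(x, y). {x, y} \<in> F}" and ?F = "{e \<in> F. e \<subseteq> W}"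
  let ?S = "{(x, y). {x, y} \<in> ?F}"
  have sF: "\<And>e. e \<in> F \<Longrightarrow> e \<subseteq> V \<and> card e = 2" and fin: "finite V"
    using assms(1) by (auto simp: simple_graph_def)
  have WV: "W \<subseteq> V"
  proof
    fix w assume "w \<in> W"
    then have "(v, w) \<in> ?R\<^sup>*" by (simp add: W_def)
    then show "w \<in> V" by (induction) (use assms(2) sF in auto)
  qed
  have reach: "(v, w) \<in> ?S\<^sup>*" if "(v, w) \<in> ?R\<^sup>*" for w
    using that
  proof induction
    case (step y z)
    then have "y \<in> W" "z \<in> W" unfolding W_def by (auto intro: rtrancl_into_rtrancl)
    with step show ?case by (auto intro: rtrancl_into_rtrancl)
  qed simp
  have symS: "sym (?S\<^sup>*)" by (rule sym_rtrancl) (auto simp: sym_def insert_commute)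
  have "v \<in> W" by (simp add: W_def)
  have conn: "connected_graph (W, ?F)"
    unfolding connected_graph_def
  proof (intro conjI ballI)
    fix x y assume "x \<in> verts (W, ?F)" "y \<in> verts (W, ?F)"
    then have "(v, x) \<in> ?S\<^sup>*" "(v, y) \<in> ?S\<^sup>*" using reach by (auto simp: W_def)
    then show "(x, y) \<in> {(x, y). {x, y} \<in> edges (W, ?F)}\<^sup>*"
      using symS by simp (meson rtrancl_trans symD)
  qed (use \<open>v \<in> W\<close> in auto)
  have sub: "subgraph (W, ?F) (V, F)"
    using WV sF fin finite_subset by (auto simp: subgraph_def simple_graph_def)
  have "K = (W, ?F)" if K: "subgraph K (V, F)" "connected_graph K" "subgraph (W, ?F) K" for K
  proof -
    have mono: "{(x, y). {x, y} \<in> edges K}\<^sup>* \<subseteq> ?R\<^sup>*"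
      by (rule rtrancl_mono) (use K(1) in \<open>auto simp: subgraph_def\<close>)
    have "v \<in> verts K" using K(3) \<open>v \<in> W\<close> by (auto simp: subgraph_def)
    then have "verts K \<subseteq> W" using K(2) mono by (fastforce simp: connected_graph_def W_def)
    then have "verts K = W" using K(3) by (auto simp: subgraph_def)
    moreover have "edges K = ?F"
      using K(1,3) \<open>verts K = W\<close> by (auto simp: subgraph_def simple_graph_def)
    ultimately show ?thesis by (metis prod.collapse)
  qed
  with sub conn show ?thesis by (auto simp: maximal_subgraph_def)
qed

text \<open>The component of \<open>v\<close> is a path, and in its list of vertices every neighbour
  of \<open>v\<close> is adjacent in index to \<open>v\<close>, which leaves two candidates for
  three distinct vertices.\<close>

lemma linear_forest_no_claw:
  assumes lf: "linear_forest (V, F)" and e: "{v, a} \<in> F" "{v, b} \<in> F" "{v, c} \<in> F"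
    and d: "a \<noteq> b" "a \<noteq> c" "b \<noteq> c"
  shows False
proof -
  let ?R = "{(x, y). {x, y} \<in> F}"
  define W where "W = {w. (v, w) \<in> ?R\<^sup>*}"
  have sg: "simple_graph (V, F)" using lf by (auto simp: linear_forest_def forest_def)
  then have vV: "v \<in> V" using e by (fastforce simp: simple_graph_def)
  have "path_graph (W, {e \<in> F. e \<subseteq> W})"
    using lf component_is_maximal[OF sg vV] by (auto simp: linear_forest_def W_def)
  then obtain xs where xs: "distinct xs" "W = set xs" "{e \<in> F. e \<subseteq> W} = walk_edges xs"
    by (auto simp: path_graph_def)
  have "v \<in> W" by (simp add: W_def)
  then obtain i where i: "i < length xs" "v = xs ! i" using xs by (auto simp: in_set_conv_nth)
  \<comment> \<open>At the ends of the path \<open>i - 1\<close> is truncated to 0 or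
    \<open>Suc i\<close> is out of range. This does no harm: the two terms only bound the number of
    possible neighbours.\<close>
  have nb: "w = xs ! (i - 1) \<or> w = xs ! Suc i" if "{v, w} \<in> F" for w
  proof -
    have "(v, w) \<in> ?R" using that by simp
    then have "w \<in> W" unfolding W_def by blast
    then have "{v, w} \<in> walk_edges xs" using xs that \<open>v \<in> W\<close> by auto
    then obtain j where j: "Suc j < length xs" "{v, w} = {xs ! j, xs ! Suc j}"
      by (auto simp: walk_edges_def)
    then consider "v = xs ! j" "w = xs ! Suc j" | "v = xs ! Suc j" "w = xs ! j"
      by (auto simp: doubleton_eq_iff)
    then show ?thesis
    proof cases
      case 1
      then have "i = j" using i j xs(1) by (simp add: nth_eq_iff_index_eq)
      then show ?thesis using 1 by simp
    next
      case 2
      then have "i = Suc j" using i j xs(1) by (simp add: nth_eq_iff_index_eq)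
      then show ?thesis using 2 by simp
    qed
  qed
  show False using nb[OF e(1)] nb[OF e(2)] nb[OF e(3)] d by metis
qed

section \<open>A sufficient condition for linear forests: consecutive positions on a line\<close>

lemma connected_graph_cut:
  assumes "connected_graph G" "x \<in> verts G" "y \<in> verts G" "x \<in> S" "y \<notin> S"
  obtains a b where "{a, b} \<in> edges G" "a \<in> S" "b \<notin> S"
proof -
  have "(x, y) \<in> {(x, y). {x, y} \<in> edges G}\<^sup>*" using assms by (auto simp: connected_graph_def)
  then have "y \<in> S \<or> (\<exists>a b. {a, b} \<in> edges G \<and> a \<in> S \<and> b \<notin> S)"
    by induction (use assms(4) in auto)
  then show thesis using assms(5) that by blast
qed

text \<open>Such a graph embeds in the path on the natural numbers. A vertex of least position on a
  cycle would have two neighbours at the same position, against injectivity; a connected subgraph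
  occupies an interval of positions, since no edge could jump over a gap.\<close>

lemma linear_forestI:
  fixes pos :: "'a \<Rightarrow> nat"
  assumes fin: "finite V" and inj: "inj_on pos V"
    and F: "\<And>e. e \<in> F \<Longrightarrow> \<exists>x\<in>V. \<exists>y\<in>V. e = {x, y} \<and> pos y = Suc (pos x)"
  shows "linear_forest (V, F)"
proof -
  have sg: "simple_graph (V, F)"
    unfolding simple_graph_def using fin by (fastforce dest!: F simp: card_2_iff)
  have adj: "pos y = Suc (pos x) \<or> pos x = Suc (pos y)" and inV: "x \<in> V" "y \<in> V"
    if "{x, y} \<in> F" for x y
    using F[OF that] by (auto simp: doubleton_eq_iff)
  have no_cycle: False if C: "subgraph C (V, F)" "cycle_graph C" for C
  proof -
    obtain xs where xs: "length xs \<ge> 3" "distinct xs" "verts C = set xs"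
        "edges C = insert {last xs, hd xs} (walk_edges xs)"
      using C(2) by (auto simp: cycle_graph_def)
    have EF: "edges C \<subseteq> F" using C(1) by (auto simp: subgraph_def)
    define n where "n = length xs"
    have step: "{xs ! i, xs ! Suc i} \<in> F" if "Suc i < n" for i
      using EF xs(4) that by (auto simp: walk_edges_def n_def)
    have "xs \<noteq> []" using xs(1) by auto
    then have wrap: "{xs ! (n - 1), xs ! 0} \<in> F"
      using EF xs(1,4) by (auto simp: last_conv_nth hd_conv_nth n_def)
    obtain i where i: "i < n" "\<And>j. j < n \<Longrightarrow> pos (xs ! i) \<le> pos (xs ! j)"
      using xs(1) ex_has_least_nat[of "\<lambda>i. i < n" 0 "\<lambda>i. pos (xs ! i)"] \<open>xs \<noteq> []\<close>
      unfolding n_def by blast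
    \<comment> \<open>\<open>s\<close> and \<open>p\<close> are the cyclic successor and predecessor
      of the index \<open>i\<close> of least position; they differ because a cycle has at least
      three vertices.\<close>
    define s where "s = (if Suc i < n then Suc i else 0)"
    define p where "p = (if i = 0 then n - 1 else i - 1)"
    have sp: "s < n" "p < n" "s \<noteq> p" using i(1) xs(1) by (auto simp: s_def p_def n_def)
    have s: "{xs ! i, xs ! s} \<in> F"
    proof (cases "Suc i < n")
      case True
      then show ?thesis using step by (simp add: s_def)
    next
      case False
      then have "i = n - 1" using i(1) by simp
      then show ?thesis using wrap False by (simp add: s_def)
    qed
    have p: "{xs ! i, xs ! p} \<in> F"
    proof (cases i)
      case 0
      then show ?thesis using wrap by (simp add: p_def insert_commute)
    next
      case (Suc k)
      then show ?thesis using step[of k] i(1) by (simp add: p_def insert_commute)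
    qed
    have "pos (xs ! s) = pos (xs ! p)"
      using adj[OF s] adj[OF p] i(2)[OF sp(1)] i(2)[OF sp(2)] by linarith
    moreover have "xs ! s \<in> V" "xs ! p \<in> V" using inV s p by blast+
    ultimately have "xs ! s = xs ! p" using inj by (auto dest: inj_onD)
    then show False using sp xs(2) by (simp add: nth_eq_iff_index_eq n_def)
  qed
  have path: "path_graph C" if C: "subgraph C (V, F)" "connected_graph C" for C
  proof -
    have CV: "verts C \<subseteq> V" and CF: "edges C \<subseteq> F" and finC: "finite (verts C)"
      and CC: "\<And>e. e \<in> edges C \<Longrightarrow> e \<subseteq> verts C"
      using C(1) by (auto simp: subgraph_def simple_graph_def)
    have ne: "verts C \<noteq> {}" using C(2) by (simp add: connected_graph_def)
    define a where "a = Min (pos ` verts C)"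
    define b where "b = Max (pos ` verts C)"
    define g where "g = the_inv_into (verts C) pos"
    have injC: "inj_on pos (verts C)" using inj CV by (rule inj_on_subset)
    have g: "g (pos v) = v" if "v \<in> verts C" for v
      unfolding g_def using injC that by (rule the_inv_into_f_f)
    have ab: "\<And>v. v \<in> verts C \<Longrightarrow> a \<le> pos v \<and> pos v \<le> b"
      using finC by (auto simp: a_def b_def)
    have "a \<in> pos ` verts C" "b \<in> pos ` verts C"
      using finC ne by (simp_all add: a_def b_def)
    then obtain x y where x: "x \<in> verts C" "pos x = a" and y: "y \<in> verts C" "pos y = b"
      by blast
    have link: "k \<in> pos ` verts C \<and> Suc k \<in> pos ` verts C \<and> {g k, g (Suc k)} \<in> edges C"
      if k: "a \<le> k" "k < b" for k
    proof -
      \<comment> \<open>Cut \<open>C\<close> between the positions \<open>k\<close> and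
        \<open>k + 1\<close>: an edge across the cut can only join exactly these two.\<close>
      obtain u w where uw: "{u, w} \<in> edges C" "pos u \<le> k" "\<not> pos w \<le> k"
        using connected_graph_cut[OF C(2) x(1) y(1), of "{v. pos v \<le> k}"] x y k by auto
      then have k': "pos u = k" "pos w = Suc k" using adj[of u w] CF by auto
      have "u \<in> verts C" "w \<in> verts C" using CC[OF uw(1)] by auto
      then show ?thesis using uw(1) g[of u] g[of w] k' by (metis imageI)
    qed
    have img: "pos ` verts C = {a..b}"
    proof (intro equalityI subsetI)
      fix k assume "k \<in> {a..b}"
      then show "k \<in> pos ` verts C" using link[of k] y by (cases "k < b") auto
    qed (use ab in auto)
    \<comment> \<open>The vertices of \<open>C\<close> sorted by position, so that a vertex
      \<open>v\<close> has index \<open>pos v - a\<close>.\<close>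
    define xs where "xs = map g [a..<Suc b]"
    have "a \<le> b" using x ab by auto
    have set_xs: "set xs = verts C"
    proof -
      have "set xs = g ` pos ` verts C" by (simp add: xs_def img atLeastLessThanSuc_atLeastAtMost del: upt_Suc)
      also have "\<dots> = verts C" using g by force
      finally show ?thesis .
    qed
    have "inj_on g {a..b}" unfolding img[symmetric] by (rule inj_onI) (auto simp: g)
    then have "distinct xs"
      by (simp add: xs_def distinct_map atLeastLessThanSuc_atLeastAtMost del: upt_Suc)
    moreover have "xs \<noteq> []" using \<open>a \<le> b\<close> by (simp add: xs_def)
    moreover have "edges C = walk_edges xs"
    proof (intro equalityI subsetI)
      fix e assume e: "e \<in> edges C"
      then obtain u w where uw: "e = {u, w}" "pos w = Suc (pos u)" using F CF by blast
      then have in_C: "u \<in> verts C" "w \<in> verts C" using CC[OF e] by auto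
      then have "a \<le> pos u" "pos w \<le> b" using ab by auto
      then have "Suc (pos u - a) < length xs" "xs ! (pos u - a) = g (pos u)"
          "xs ! Suc (pos u - a) = g (pos w)"
        using uw by (auto simp: xs_def nth_append simp del: upt_Suc)
      then have "e = {xs ! (pos u - a), xs ! Suc (pos u - a)}" using uw(1) g in_C by simp
      then show "e \<in> walk_edges xs"
        using \<open>Suc (pos u - a) < length xs\<close> unfolding walk_edges_def by blast
    next
      fix e assume "e \<in> walk_edges xs"
      then obtain i where i: "Suc i < length xs" "e = {xs ! i, xs ! Suc i}"
        by (auto simp: walk_edges_def)
      then have "e = {g (a + i), g (Suc (a + i))}" "a + i < b"
        by (auto simp: xs_def simp del: upt_Suc)
      then show "e \<in> edges C" using link[of "a + i"] by simp
    qed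
    ultimately show ?thesis using set_xs by (auto simp: path_graph_def)
  qed
  have "forest (V, F)" unfolding forest_def using sg no_cycle by blast
  moreover have "path_graph C" if "maximal_subgraph connected_graph C (V, F)" for C
    using that path by (simp add: maximal_subgraph_def)
  ultimately show ?thesis by (simp add: linear_forest_def)
qed

subsection \<open>Chords of the circle\<close>

text \<open>
  The rational parametrisation of the unit circle turns the circular order into the order of
  the parameters: the equation of the line through the points \<open>s\<close> and \<open>t\<close> takes at the
  point \<open>k\<close> the sign of \<open>(k - s) (t - k)\<close>.
\<close>

definition circle_point :: "nat \<Rightarrow> complex" where
  "circle_point k = Complex ((1 - (real k)\<^sup>2) / (1 + (real k)\<^sup>2)) (2 * real k / (1 + (real k)\<^sup>2))"

definition chord_form :: "nat \<Rightarrow> nat \<Rightarrow> complex \<Rightarrow> real" where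
  "chord_form s t z = Re z * (1 - real s * real t) + Im z * (real s + real t) - (1 + real s * real t)"

lemma one_plus_square_pos: "1 + (x::real)\<^sup>2 > 0"
  by (simp add: add_pos_nonneg)

lemma norm_circle_point: "norm (circle_point k) = 1"
proof -
  have "(1 - (real k)\<^sup>2)\<^sup>2 + (2 * real k)\<^sup>2 = (1 + (real k)\<^sup>2)\<^sup>2" by algebra
  then have "((1 - (real k)\<^sup>2) / (1 + (real k)\<^sup>2))\<^sup>2 + (2 * real k / (1 + (real k)\<^sup>2))\<^sup>2 = 1"
    using one_plus_square_pos[of "real k"]
    by (simp add: power_divide flip: add_divide_distrib)
  then show ?thesis by (simp add: circle_point_def complex_norm)
qed

lemma chord_form_circle_point:
  "chord_form s t (circle_point k) =
    2 * ((real k - real s) * (real t - real k)) / (1 + (real k)\<^sup>2)"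
proof -
  \<comment> \<open>Collecting everything over one abstract denominator leaves a polynomial identity
    between numerators, which \<open>algebra\<close> can decide.\<close>
  have "X / D * p + Y / D * q - r = (X * p + Y * q - r * D) / D" if "D \<noteq> 0" for X Y D p q r :: real
    using that by (simp add: field_simps)
  from this[of "1 + (real k)\<^sup>2"]
  have "chord_form s t (circle_point k) =
      ((1 - (real k)\<^sup>2) * (1 - real s * real t) + 2 * real k * (real s + real t)
        - (1 + real s * real t) * (1 + (real k)\<^sup>2)) / (1 + (real k)\<^sup>2)"
    using one_plus_square_pos[of "real k"] by (simp add: chord_form_def circle_point_def)
  also have "(1 - (real k)\<^sup>2) * (1 - real s * real t) + 2 * real k * (real s + real t)
        - (1 + real s * real t) * (1 + (real k)\<^sup>2) = 2 * ((real k - real s) * (real t - real k))"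
    by algebra
  finally show ?thesis .
qed

lemma chord_form_eq_0_iff: "chord_form s t (circle_point k) = 0 \<longleftrightarrow> k = s \<or> k = t"
  using one_plus_square_pos[of "real k"] by (auto simp: chord_form_circle_point)

text \<open>The zero set of \<open>chord_form s s\<close> is the tangent at the point
  \<open>s\<close>, which meets the circle only there.\<close>

lemma inj_circle_point: "inj circle_point"
  by (rule injI) (metis chord_form_eq_0_iff)

lemma chord_form_inside:
  assumes "s \<le> k" "k \<le> t"
  shows "chord_form s t (circle_point k) \<ge> 0"
proof -
  have "0 \<le> (real k - real s) * (real t - real k)"
    using assms by (intro mult_nonneg_nonneg) auto
  then show ?thesis
    unfolding chord_form_circle_point
    by (intro divide_nonneg_pos one_plus_square_pos) simp
qed

lemma chord_form_outside:
  assumes "s \<le> t" "k \<le> s \<or> t \<le> k"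
  shows "chord_form s t (circle_point k) \<le> 0"
proof -
  have "(real k - real s) * (real t - real k) \<le> 0"
    using assms by (auto intro: mult_nonneg_nonpos mult_nonpos_nonneg)
  then show ?thesis
    unfolding chord_form_circle_point
    by (intro divide_nonpos_pos one_plus_square_pos) simp
qed

lemma chord_form_affine:
  "chord_form s t ((1 - u) *\<^sub>R z + u *\<^sub>R w) = (1 - u) * chord_form s t z + u * chord_form s t w"
  by (simp add: chord_form_def algebra_simps)

lemma chord_form_segment:
  assumes "z \<in> closed_segment (circle_point s) (circle_point t)"
  shows "chord_form s t z = 0"
proof -
  obtain u where "z = (1 - u) *\<^sub>R circle_point s + u *\<^sub>R circle_point t"
    using assms by (auto simp: closed_segment_def)
  moreover have "chord_form s t (circle_point s) = 0" "chord_form s t (circle_point t) = 0"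
    by (simp_all add: chord_form_eq_0_iff)
  ultimately show ?thesis by (simp add: chord_form_affine)
qed

lemma circle_point_in_chord_iff:
  "circle_point k \<in> closed_segment (circle_point s) (circle_point t) \<longleftrightarrow> k = s \<or> k = t"
  using chord_form_segment[of "circle_point k" s t] by (auto simp: chord_form_eq_0_iff)

text \<open>For \<open>a < b\<close> and \<open>c < d\<close> these are the two ways in which the
  ends of two chords can alternate; strictness excludes chords with a common end.\<close>

definition interleaved :: "nat \<Rightarrow> nat \<Rightarrow> nat \<Rightarrow> nat \<Rightarrow> bool" where
  "interleaved a b c d \<longleftrightarrow> a < c \<and> c < b \<and> b < d \<or> c < a \<and> a < d \<and> d < b"

text \<open>The ends \<open>c\<close> and \<open>d\<close> lie weakly on one side of the line
  through \<open>a\<close> and \<open>b\<close>. A convex combination of two numbers without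
  opposite signs vanishes only if both terms do, so a common point must be an end of one chord lying
  on the other.\<close>

lemma chords_meet_in_common_ends:
  assumes "a < b" "c < d" "{a, b} \<noteq> {c, d}" "\<not> interleaved a b c d"
  shows "closed_segment (circle_point a) (circle_point b) \<inter>
    closed_segment (circle_point c) (circle_point d) \<subseteq> circle_point ` ({a, b} \<inter> {c, d})"
proof
  let ?f = "\<lambda>k. chord_form a b (circle_point k)"
  fix z assume z: "z \<in> closed_segment (circle_point a) (circle_point b) \<inter>
    closed_segment (circle_point c) (circle_point d)"
  then obtain u where u: "0 \<le> u" "u \<le> 1" "z = (1 - u) *\<^sub>R circle_point c + u *\<^sub>R circle_point d"
    by (auto simp: closed_segment_def)
  have "(1 - u) * ?f c + u * ?f d = 0"
    using chord_form_segment[of z a b] z u chord_form_affine by auto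
  moreover have "0 \<le> ?f c \<and> 0 \<le> ?f d \<or> ?f c \<le> 0 \<and> ?f d \<le> 0"
  proof -
    \<comment> \<open>Both ends lie in the closed interval from \<open>a\<close> to
      \<open>b\<close>, or both lie outside the open one.\<close>
    have "a \<le> c \<and> c \<le> b \<and> a \<le> d \<and> d \<le> b \<or> (c \<le> a \<or> b \<le> c) \<and> (d \<le> a \<or> b \<le> d)"
      using assms unfolding interleaved_def by linarith
    then show ?thesis
      using chord_form_inside[of a _ b] chord_form_outside[of a b] \<open>a < b\<close>
      by (meson less_imp_le)
  qed
  then have "0 \<le> (1 - u) * ?f c \<and> 0 \<le> u * ?f d \<or> (1 - u) * ?f c \<le> 0 \<and> u * ?f d \<le> 0"
    using u(1,2) by (auto intro: mult_nonneg_nonneg mult_nonneg_nonpos)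
  ultimately have "(1 - u) * ?f c = 0" "u * ?f d = 0" by linarith+
  then have cu: "u = 1 \<or> c = a \<or> c = b" and du: "u = 0 \<or> d = a \<or> d = b"
    by (auto simp: chord_form_eq_0_iff)
  have "\<not> ((c = a \<or> c = b) \<and> (d = a \<or> d = b))" using assms(1-3) by auto
  then consider "u = 1" "d \<in> {a, b}" | "u = 0" "c \<in> {a, b}" using cu du by auto
  then show "z \<in> circle_point ` ({a, b} \<inter> {c, d})"
    by cases (use u(3) in auto)
qed

text \<open>A 2-connected graph is its own only block, by maximality. Draw the vertex
  \<open>k\<close> at \<open>circle_point k\<close> and the edges as straight chords; edges that
  cross are then interleaved, and \<open>cross\<close> allows each edge only one such
  partner.\<close>

lemma pseudo_outerplanar_if_circular_order:
  fixes G :: "nat graph"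
  assumes sg: "simple_graph G" and kc: "k_connected 2 G"
    and cross: "\<And>a b c d c' d'. \<lbrakk>a < b; c < d; c' < d'; {a, b} \<in> edges G; {c, d} \<in> edges G;
      {c', d'} \<in> edges G; interleaved a b c d; interleaved a b c' d'\<rbrakk> \<Longrightarrow> {c, d} = {c', d'}"
  shows "pseudo_outerplanar G"
  unfolding pseudo_outerplanar_def
proof (intro allI impI)
  fix H assume "block H G"
  moreover have "subgraph G G" using sg by (simp add: subgraph_def)
  ultimately have [simp]: "H = G"
    using kc unfolding block_def maximal_subgraph_def by metis
  \<comment> \<open>\<open>Min\<close> and \<open>Max\<close> choose an orientation of the unordered
    edge.\<close>
  define \<gamma> where "\<gamma> = (\<lambda>e. linepath (circle_point (Min e)) (circle_point (Max e)))"
  have ord: "\<exists>a b. e = {a, b} \<and> a < b" if "e \<in> edges G" for e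
  proof -
    have "card e = 2" using sg that by (simp add: simple_graph_def)
    then obtain x y where "e = {x, y}" "x \<noteq> y" by (meson card_2_iff)
    then show ?thesis by (metis insert_commute linorder_neqE_nat)
  qed
  have \<gamma>: "\<gamma> {a, b} = linepath (circle_point a) (circle_point b)" if "a < b" for a b
    using that by (simp add: \<gamma>_def)
  have "disk_drawing G 0 1 circle_point \<gamma>"
    unfolding disk_drawing_def
  proof (intro conjI ballI)
    show "inj_on circle_point (verts G)" using inj_circle_point by (rule inj_on_subset) simp
    show "circle_point ` verts G \<subseteq> sphere 0 1" by (auto simp: norm_circle_point)
    fix e assume e: "e \<in> edges G"
    then obtain a b where ab: "e = {a, b}" "a < b" using ord by blast
    have "{a, b} \<subseteq> verts G" using sg e ab by (auto simp: simple_graph_def)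
    have ne: "circle_point a \<noteq> circle_point b" using ab inj_circle_point by (auto dest: injD)
    show "arc (\<gamma> e)" using ab ne by (simp add: \<gamma>)
    show "{pathstart (\<gamma> e), pathfinish (\<gamma> e)} = circle_point ` e" using ab by (simp add: \<gamma>)
    show "path_image (\<gamma> e) \<subseteq> cball 0 1"
      using ab by (simp add: \<gamma> closed_segment_subset norm_circle_point)
    show "path_image (\<gamma> e) \<inter> circle_point ` verts G = circle_point ` e"
      using ab \<open>{a, b} \<subseteq> verts G\<close> by (auto simp: \<gamma> circle_point_in_chord_iff)
  qed simp
  moreover have "card {f \<in> edges G. edges_cross circle_point \<gamma> e f} \<le> 1" if e: "e \<in> edges G" for e
  proof -
    obtain a b where ab: "e = {a, b}" "a < b" using ord e by blast
    have chord: "\<exists>c d. f = {c, d} \<and> c < d \<and> interleaved a b c d"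
      if f: "f \<in> edges G" "edges_cross circle_point \<gamma> e f" for f
    proof -
      obtain c d where cd: "f = {c, d}" "c < d" using ord f by blast
      then have "interleaved a b c d"
        using f(2) chords_meet_in_common_ends[of a b c d] ab
        by (auto simp: edges_cross_def \<gamma>)
      with cd show ?thesis by blast
    qed
    have "f = g" if "f \<in> {f \<in> edges G. edges_cross circle_point \<gamma> e f}"
        "g \<in> {f \<in> edges G. edges_cross circle_point \<gamma> e f}" for f g
      using chord[of f] chord[of g] that cross ab e by blast
    moreover have "finite {f \<in> edges G. edges_cross circle_point \<gamma> e f}"
    proof (rule finite_subset)
      show "{f \<in> edges G. edges_cross circle_point \<gamma> e f} \<subseteq> Pow (verts G)"
        using sg by (auto simp: simple_graph_def)
      show "finite (Pow (verts G))" using sg by (simp add: simple_graph_def)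
    qed
    ultimately show ?thesis by (simp add: card_le_Suc0_iff_eq)
  qed
  ultimately show "\<exists>c r p \<gamma>. disk_drawing H c r p \<gamma> \<and>
      (\<forall>e\<in>edges H. card {f \<in> edges H. edges_cross p \<gamma> e f} \<le> 1)"
    unfolding \<open>H = G\<close> by blast
qed

subsection \<open>Connectivity along a Hamiltonian cycle\<close>

lemma connected_graphI_sequence:
  assumes V: "verts G = f ` {..<N}" and "N > 0"
    and E: "\<And>j. Suc j < N \<Longrightarrow> {f j, f (Suc j)} \<in> edges G"
  shows "connected_graph G"
proof -
  let ?R = "{(x, y). {x, y} \<in> edges G}"
  have sym: "sym (?R\<^sup>*)" by (rule sym_rtrancl) (auto simp: sym_def insert_commute)
  have reach: "(f 0, f j) \<in> ?R\<^sup>*" if "j < N" for j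
    using that
  proof (induction j)
    case (Suc j)
    then show ?case using E[of j] by (auto intro: rtrancl_into_rtrancl)
  qed simp
  have "(u, v) \<in> ?R\<^sup>*" if "u \<in> verts G" "v \<in> verts G" for u v
  proof -
    have "(f 0, u) \<in> ?R\<^sup>*" "(f 0, v) \<in> ?R\<^sup>*" using that V reach by auto
    then show ?thesis using sym by (meson rtrancl_trans symD)
  qed
  then show ?thesis using V \<open>N > 0\<close> by (auto simp: connected_graph_def)
qed

text \<open>Deleting one vertex from a Hamiltonian cycle leaves a Hamiltonian path.\<close>

lemma two_connected_if_hamiltonian:
  assumes V: "verts G = {..<n}" and n: "n > 2"
    and E: "\<And>k. Suc k < n \<Longrightarrow> {k, Suc k} \<in> edges G" and wrap: "{n - 1, 0} \<in> edges G"
  shows "k_connected 2 G"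
  unfolding k_connected_def
proof (intro conjI allI impI)
  show "card (verts G) > 2" using V n by simp
  fix X assume X: "X \<subseteq> verts G" "card X < 2"
  have "finite X" using X V finite_subset by auto
  then consider "X = {}" | x where "X = {x}"
    using X(2) by (metis One_nat_def card_0_eq card_1_singletonE less_2_cases)
  then show "connected_graph (delete_verts G X)"
  proof cases
    case 1
    show ?thesis
      by (rule connected_graphI_sequence[where f = id and N = n])
         (use V E n 1 in \<open>auto simp: delete_verts_def\<close>)
  next
    case 2
    then have x: "x < n" using X V by auto
    \<comment> \<open>The remaining vertices in cyclic order, starting just after \<open>x\<close>;
      the subtraction is reduction modulo \<open>n\<close>.\<close>
    define f where "f = (\<lambda>j. if x + 1 + j < n then x + 1 + j else x + 1 + j - n)"
    show ?thesis
    proof (rule connected_graphI_sequence[where f = f and N = "n - 1"])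
      have "{..<n} - {x} = f ` {..<n - 1}"
      proof (intro equalityI subsetI)
        fix k assume k: "k \<in> {..<n} - {x}"
        then consider "x < k" | "k < x" by fastforce
        then show "k \<in> f ` {..<n - 1}"
        proof cases
          case 1
          then show ?thesis using k by (intro image_eqI[of _ _ "k - x - 1"]) (auto simp: f_def)
        next
          case 2
          then show ?thesis using k x
            by (intro image_eqI[of _ _ "k + n - x - 1"]) (auto simp: f_def)
        qed
      qed (use x in \<open>auto simp: f_def split: if_splits\<close>)
      then show "verts (delete_verts G X) = f ` {..<n - 1}" using V 2 by (simp add: delete_verts_def)
      show "n - 1 > 0" using n by simp
      fix j assume j: "Suc j < n - 1"
      have "f j \<noteq> x" "f (Suc j) \<noteq> x" using j x by (auto simp: f_def split: if_splits)
      moreover have "{f j, f (Suc j)} \<in> edges G"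
      proof -
        \<comment> \<open>The step from \<open>f j\<close> to \<open>f (Suc j)\<close> comes before,
          at or after the passage from \<open>n - 1\<close> to 0.\<close>
        consider "x + 2 + j < n" | "x + 2 + j = n" | "n < x + 2 + j" by linarith
        then show ?thesis
        proof cases
          case 1
          then show ?thesis using E[of "x + 1 + j"] by (simp add: f_def)
        next
          case 2
          then have "f j = n - 1" "f (Suc j) = 0" by (auto simp: f_def)
          then show ?thesis using wrap by simp
        next
          case 3
          then have "f j = x + 1 + j - n" "f (Suc j) = Suc (x + 1 + j - n)"
            by (auto simp: f_def)
          then show ?thesis using E[of "x + 1 + j - n"] j x by simp
        qed
      qed
      ultimately show "{f j, f (Suc j)} \<in> edges (delete_verts G X)"
        using 2 by (simp add: delete_verts_def)
    qed
  qed
qed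

subsection \<open>The ring of gadgets\<close>

text \<open>Gadget \<open>i\<close> has \<open>u, w, t, x, v\<close> at
  \<open>5 * i, ..., 5 * i + 4\<close>. The case \<open>b = a + 1\<close> covers the outer path of
  each gadget and the links between successive gadgets, the next case closes the ring, and the last
  four are the chords \<open>ux\<close>, \<open>uv\<close>, \<open>wx\<close>,
  \<open>wv\<close>.\<close>

definition ring_adj :: "nat \<Rightarrow> nat \<Rightarrow> nat \<Rightarrow> bool" where
  "ring_adj L a b \<longleftrightarrow> a < b \<and> b < 5 * L \<and>
     (b = a + 1 \<or> a = 0 \<and> b = 5 * L - 1 \<or>
      a mod 5 = 0 \<and> b = a + 3 \<or> a mod 5 = 0 \<and> b = a + 4 \<or>
      a mod 5 = 1 \<and> b = a + 2 \<or> a mod 5 = 1 \<and> b = a + 3)"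

definition ring_graph :: "nat \<Rightarrow> nat graph" where
  "ring_graph L = ({..<5 * L}, {{a, b} | a b. ring_adj L a b})"

lemma verts_ring_graph [simp]: "verts (ring_graph L) = {..<5 * L}"
  by (simp add: ring_graph_def)

lemma edge_ring_graph_iff:
  "{a, b} \<in> edges (ring_graph L) \<longleftrightarrow> ring_adj L a b \<or> ring_adj L b a"
  by (auto simp: ring_graph_def doubleton_eq_iff)

lemma simple_graph_ring_graph: "simple_graph (ring_graph L)"
proof -
  have "{a, b} \<subseteq> {..<5 * L} \<and> card {a, b} = 2" if "ring_adj L a b" for a b
    using that by (auto simp: ring_adj_def)
  then show ?thesis unfolding simple_graph_def ring_graph_def by auto
qed

lemma two_connected_ring_graph:
  assumes "L \<ge> 1"
  shows "k_connected 2 (ring_graph L)"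
  by (rule two_connected_if_hamiltonian[where n = "5 * L"])
     (use assms in \<open>auto simp: edge_ring_graph_iff ring_adj_def\<close>)

text \<open>Edges between neighbours on the circle cross nothing; comparing the residues of the four
  kinds of chords leaves only \<open>ux\<close> against \<open>wv\<close> of the same
  gadget.\<close>

lemma interleaved_ring_adj:
  assumes "ring_adj L a b" "ring_adj L c d" "a < c" "c < b" "b < d"
  shows "a mod 5 = 0 \<and> b = a + 3 \<and> c = a + 1 \<and> d = a + 4"
proof -
  have "d < 5 * L" using assms(2) by (simp add: ring_adj_def)
  then have ne: "b \<noteq> a + 1" "d \<noteq> c + 1" "b \<noteq> 5 * L - 1" "c \<noteq> 0" using assms(3-5) by auto
  have ab: "a mod 5 = 0 \<and> b = a + 3 \<or> a mod 5 = 0 \<and> b = a + 4 \<or>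
      a mod 5 = 1 \<and> b = a + 2 \<or> a mod 5 = 1 \<and> b = a + 3"
    using assms(1) ne unfolding ring_adj_def by blast
  have cd: "c mod 5 = 0 \<and> d = c + 3 \<or> c mod 5 = 0 \<and> d = c + 4 \<or>
      c mod 5 = 1 \<and> d = c + 2 \<or> c mod 5 = 1 \<and> d = c + 3"
    using assms(2) ne unfolding ring_adj_def by blast
  have shift: "x mod 5 = 0 \<Longrightarrow> (x + 1) mod 5 = 1 \<and> (x + 2) mod 5 = 2 \<and> (x + 3) mod 5 = 3"
      "x mod 5 = 1 \<Longrightarrow> (x + 1) mod 5 = 2 \<and> (x + 2) mod 5 = 3" for x :: nat
    by presburger+
  have "c = a + 1 \<or> c = a + 2 \<or> c = a + 3" using ab assms(3,4) by auto
  then show ?thesis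
    using ab cd assms(3-5) shift[of a] by (elim disjE conjE) simp_all
qed

lemma pseudo_outerplanar_ring_graph:
  assumes "L \<ge> 1"
  shows "pseudo_outerplanar (ring_graph L)"
proof (rule pseudo_outerplanar_if_circular_order)
  fix a b c d c' d'
  assume less: "a < b" "c < d" "c' < d'"
    and "{a, b} \<in> edges (ring_graph L)" "{c, d} \<in> edges (ring_graph L)" "{c', d'} \<in> edges (ring_graph L)"
    and il: "interleaved a b c d" "interleaved a b c' d'"
  then have adj: "ring_adj L a b" "ring_adj L c d" "ring_adj L c' d'"
    by (auto simp: edge_ring_graph_iff ring_adj_def)
  \<comment> \<open>No edge plays both the role of \<open>ux\<close> and that of \<open>wv\<close>,
    so its role determines its partner.\<close>
  have not_both: "\<not> (x mod 5 = 0 \<and> (x + 1) mod 5 = 0)" for x :: nat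
    by presburger
  have "a mod 5 = 0 \<and> b = a + 3 \<and> x = a + 1 \<and> y = a + 4 \<or>
      x mod 5 = 0 \<and> y = x + 3 \<and> a = x + 1 \<and> b = x + 4"
    if "ring_adj L x y" "interleaved a b x y" for x y
    using interleaved_ring_adj[OF adj(1) that(1)] interleaved_ring_adj[OF that(1) adj(1)] that(2)
    unfolding interleaved_def by blast
  from this[OF adj(2) il(1)] this[OF adj(3) il(2)]
  have "c = c' \<and> d = d'"
    using not_both[of c] not_both[of c'] by auto
  then show "{c, d} = {c', d'}" by simp
qed (use assms simple_graph_ring_graph two_connected_ring_graph in auto)

subsection \<open>Degrees\<close>

lemma degree_le_card_neighbours:
  assumes "simple_graph G" "finite N" "\<And>w. {v, w} \<in> edges G \<Longrightarrow> w \<in> N"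
  shows "degree G v \<le> card N"
proof -
  have "{e \<in> edges G. v \<in> e} \<subseteq> (\<lambda>w. {v, w}) ` N"
  proof
    fix e assume e: "e \<in> {e \<in> edges G. v \<in> e}"
    then have "card e = 2" "v \<in> e" using assms(1) by (auto simp: simple_graph_def)
    then obtain w where "e = {v, w}" by (auto simp: card_2_iff)
    then show "e \<in> (\<lambda>w. {v, w}) ` N" using e assms(3) by auto
  qed
  then show ?thesis
    using assms(2) unfolding degree_def
    by (meson card_image_le card_mono finite_imageI le_trans)
qed

lemma degree_ring_graph_le: "degree (ring_graph L) v \<le> 4"
proof -
  define r where "r = v mod 5"
  \<comment> \<open>One case for each of \<open>u, w, t, x, v\<close>. The inner conditionals handle
    the closing edge at vertex 0 and at the last vertex.\<close>
  define N where "N = (if r = 0 then {v + 1, v + 3, v + 4, if v = 0 then 5 * L - 1 else v - 1}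
    else if r = 1 then {v - 1, v + 1, v + 2, v + 3}
    else if r = 2 then {v - 1, v + 1}
    else if r = 3 then {v - 1, v + 1, v - 2, v - 3}
    else {v - 1, v - 3, v - 4, if Suc v = 5 * L then 0 else v + 1})"
  have le4: "card {x, y, z, t} \<le> 4" "card {x, y} \<le> 4" for x y z t :: nat
    using card_length[of "[x, y, z, t]"] card_length[of "[x, y]"] by simp_all
  have "w \<in> N" if vw: "{v, w} \<in> edges (ring_graph L)" for w
  proof -
    consider "ring_adj L v w" | "ring_adj L w v" using vw by (auto simp: edge_ring_graph_iff)
    then show ?thesis
    proof cases
      case 1
      then have "w = v + 1 \<and> Suc v \<noteq> 5 * L \<or> v = 0 \<and> w = 5 * L - 1 \<or>
          r = 0 \<and> (w = v + 3 \<or> w = v + 4) \<or> r = 1 \<and> (w = v + 2 \<or> w = v + 3)"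
        unfolding ring_adj_def r_def by auto
      then show ?thesis by (elim disjE conjE) (simp_all add: N_def r_def)
    next
      case 2
      have shift: "x mod 5 = 0 \<Longrightarrow> (x + 3) mod 5 = 3 \<and> (x + 4) mod 5 = 4"
          "x mod 5 = 1 \<Longrightarrow> (x + 2) mod 5 = 3 \<and> (x + 3) mod 5 = 4" for x :: nat
        by presburger+
      have last: "r = 4" if "v = 5 * L - 1" "w < v"
      proof -
        have "v = 5 * (L - 1) + 4" using that by auto
        then show ?thesis unfolding r_def by simp
      qed
      then have "v = w + 1 \<or> w = 0 \<and> Suc v = 5 * L \<and> r = 4 \<or>
          r = 3 \<and> (v = w + 3 \<or> v = w + 2) \<or> r = 4 \<and> (v = w + 4 \<or> v = w + 3)"
        using 2 shift[of w] last unfolding ring_adj_def r_def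
        by (elim conjE disjE) simp_all
      then show ?thesis by (elim disjE conjE) (simp_all add: N_def)
    qed
  qed
  moreover have "card N \<le> 4" unfolding N_def by (simp only: le4 split: if_split) simp
  moreover have "finite N" by (simp add: N_def)
  ultimately show ?thesis
    using degree_le_card_neighbours[OF simple_graph_ring_graph] le_trans by metis
qed

text \<open>Vertex 1 is \<open>w\<close> of the first gadget, whose four neighbours all lie in that
  gadget.\<close>

lemma degree_ring_graph_one:
  assumes "L \<ge> 1"
  shows "degree (ring_graph L) 1 \<ge> 4"
proof -
  have sub: "{{1, 0}, {1, 2}, {1, 3}, {1, 4}} \<subseteq> {e \<in> edges (ring_graph L). 1 \<in> e}"
    using assms by (auto simp: edge_ring_graph_iff ring_adj_def)
  have fin: "finite {e \<in> edges (ring_graph L). 1 \<in> e}"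
    by (rule finite_subset[of _ "Pow {..<5 * L}"])
      (use simple_graph_ring_graph[of L] in \<open>auto simp: simple_graph_def\<close>)
  have "card {{1, 0}, {1, 2}, {1, 3}, {1, 4::nat}} = 4"
    by (simp add: doubleton_eq_iff)
  then show ?thesis unfolding degree_def using card_mono[OF fin sub] by simp
qed

lemma max_degree_ring_graph:
  assumes "L \<ge> 1"
  shows "max_degree (ring_graph L) = 4"
  unfolding max_degree_def
proof (rule Max_eqI)
  have "degree (ring_graph L) 1 = 4"
    using degree_ring_graph_le degree_ring_graph_one[OF assms] by (rule le_antisym)
  then show "4 \<in> degree (ring_graph L) ` verts (ring_graph L)" using assms by force
qed (use degree_ring_graph_le in auto)

subsection \<open>Two linear forests do not suffice\<close>

text \<open>With one Boolean per edge, the absence of monochromatic claws and cycles becomes a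
  finite propositional problem.\<close>

lemma gadget_links_differ:
  assumes lf: "linear_forest (V, A)" "linear_forest (V, B)"
    and e: "{u, w} \<in> A \<union> B" "{w, t} \<in> A \<union> B" "{t, x} \<in> A \<union> B" "{x, v} \<in> A \<union> B"
      "{w, x} \<in> A \<union> B" "{u, x} \<in> A \<union> B" "{w, v} \<in> A \<union> B" "{u, v} \<in> A \<union> B"
      "{u, p} \<in> A \<union> B" "{v, r} \<in> A \<union> B"
    and d: "distinct [u, w, t, x, v]" "p \<notin> {u, w, t, x, v}" "r \<notin> {u, w, t, x, v}"
  shows "{u, p} \<in> A \<longleftrightarrow> {v, r} \<notin> A"
proof -
  \<comment> \<open>An edge that is not \<open>col\<close> lies in \<open>B\<close>, even if
    \<open>A\<close> and \<open>B\<close> overlap. So each claw or cycle yields two clauses: not all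
    of its edges are \<open>col\<close>, by \<open>A\<close>, and not all fail to be, by
    \<open>B\<close>.\<close>
  define col where "col a b \<longleftrightarrow> {a, b} \<in> A" for a b
  define adj where "adj a b \<longleftrightarrow> {a, b} \<in> A \<union> B" for a b
  have col_sym: "col a b \<longleftrightarrow> col b a" and adj_sym: "adj a b \<longleftrightarrow> adj b a" for a b
    by (simp_all add: col_def adj_def insert_commute)
  have adj: "adj u w" "adj w t" "adj t x" "adj x v" "adj w x" "adj u x" "adj w v" "adj u v"
      "adj u p" "adj v r"
    using e by (auto simp: adj_def)
  note adj = adj adj[THEN adj_sym[THEN iffD1]]
  have claw: "\<not> (col z a \<and> col z b \<and> col z c) \<and> (col z a \<or> col z b \<or> col z c)"
    if "adj z a" "adj z b" "adj z c" "a \<noteq> b" "a \<noteq> c" "b \<noteq> c" for z a b c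
    using linear_forest_no_claw[OF lf(1), of z a b c] linear_forest_no_claw[OF lf(2), of z a b c] that
    by (auto simp: col_def adj_def)
  have cycle4: "\<not> (col a b \<and> col b c \<and> col c d \<and> col d a) \<and> (col a b \<or> col b c \<or> col c d \<or> col d a)"
    if "adj a b" "adj b c" "adj c d" "adj d a" "distinct [a, b, c, d]" for a b c d
    using forest_no_cycle[of V A "[a, b, c, d]"] forest_no_cycle[of V B "[a, b, c, d]"] lf that
    by (auto simp: linear_forest_def col_def adj_def)
  have cycle5: "\<not> (col a b \<and> col b c \<and> col c d \<and> col d e \<and> col e a) \<and>
      (col a b \<or> col b c \<or> col c d \<or> col d e \<or> col e a)"
    if "adj a b" "adj b c" "adj c d" "adj d e" "adj e a" "distinct [a, b, c, d, e]" for a b c d e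
    using forest_no_cycle[of V A "[a, b, c, d, e]"] forest_no_cycle[of V B "[a, b, c, d, e]"] lf that
    by (auto simp: linear_forest_def col_def adj_def)
  have neqs: "u \<noteq> w" "u \<noteq> t" "u \<noteq> x" "u \<noteq> v" "w \<noteq> t" "w \<noteq> x" "w \<noteq> v" "t \<noteq> x" "t \<noteq> v" "x \<noteq> v"
      "p \<noteq> u" "p \<noteq> w" "p \<noteq> x" "p \<noteq> v" "r \<noteq> u" "r \<noteq> w" "r \<noteq> x" "r \<noteq> v"
    using d by auto
  note neqs = neqs neqs[symmetric]
  \<comment> \<open>All triples of edges at \<open>u\<close>, \<open>v\<close>, \<open>w\<close> and
    \<open>x\<close>: each of these vertices has exactly two edges of either colour.\<close>
  note claws = claw[of u w x v] claw[of u w x p] claw[of u w v p] claw[of u x v p]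
    claw[of v x w u] claw[of v x w r] claw[of v x u r] claw[of v w u r]
    claw[of w u t x] claw[of w u t v] claw[of w u x v] claw[of w t x v]
    claw[of x t v w] claw[of x t v u] claw[of x t w u] claw[of x v w u]
  \<comment> \<open>The three 4-cycles of the K4, and the two 5-cycles that arise by rerouting
    \<open>wx\<close> through \<open>t\<close>.\<close>
  note cycles = cycle4[of u w x v] cycle4[of u v w x] cycle4[of u w v x]
    cycle5[of u w t x v] cycle5[of u v w t x]
  note claws = claws[simplified adj neqs simp_thms True_implies_equals]
  note cycles = cycles[simplified adj neqs simp_thms True_implies_equals distinct.simps list.set insert_iff empty_iff]
  \<comment> \<open>These degree bounds and five cycles already suffice; the path argument is not needed.\<close>
  have "col u p \<longleftrightarrow> \<not> col v r"
    using claws cycles col_sym[of w u] col_sym[of x u] col_sym[of x w] col_sym[of v u]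
      col_sym[of v w] col_sym[of v x] col_sym[of t w] col_sym[of x t]
    by sat
  then show ?thesis by (simp add: col_def)
qed

lemma ring_graph_not_two_linear_forests:
  assumes L: "odd L" "L \<ge> 2" and lf: "linear_forest (V, A)" "linear_forest (V, B)"
    and cover: "edges (ring_graph L) \<subseteq> A \<union> B"
  shows False
proof -
  \<comment> \<open>\<open>link i\<close> enters gadget \<open>i\<close> at \<open>u\<close>. The
    closing edge is both \<open>link 0\<close> and \<open>link L\<close>, so \<open>L\<close> colour
    changes, an odd number, must restore its colour.\<close>
  define link where "link i = (if i = 0 \<or> i = L then {0, 5 * L - 1} else {5 * i - 1, 5 * i})" for i
  have alternate: "link i \<in> A \<longleftrightarrow> link (Suc i) \<notin> A" if i: "i < L" for i
  proof -
    \<comment> \<open>\<open>p\<close> and \<open>r\<close> are the neighbours of \<open>u\<close>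
      and \<open>v\<close> in the adjacent gadgets; \<open>L \<ge> 2\<close> keeps them outside
      gadget \<open>i\<close>.\<close>
    define p where "p = (if i = 0 then 5 * L - 1 else 5 * i - 1)"
    define r where "r = (if Suc i = L then 0 else 5 * i + 5)"
    have in_AB: "{a, b} \<in> A \<union> B" if "ring_adj L a b \<or> ring_adj L b a" for a b
      using that cover edge_ring_graph_iff[of a b L] by blast
    have "{5 * i, p} \<in> A \<longleftrightarrow> {5 * i + 4, r} \<notin> A"
    proof (rule gadget_links_differ[OF lf, where w = "5 * i + 1" and t = "5 * i + 2" and x = "5 * i + 3"])
      show "{5 * i, p} \<in> A \<union> B" using i by (intro in_AB) (auto simp: ring_adj_def p_def)
      show "{5 * i + 4, r} \<in> A \<union> B" using i by (intro in_AB) (auto simp: ring_adj_def r_def)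
      show "p \<notin> {5 * i, 5 * i + 1, 5 * i + 2, 5 * i + 3, 5 * i + 4}" using L(2) by (auto simp: p_def)
      show "r \<notin> {5 * i, 5 * i + 1, 5 * i + 2, 5 * i + 3, 5 * i + 4}" using L(2) by (auto simp: r_def)
    qed (use i in \<open>auto intro!: in_AB simp: ring_adj_def simp del: Un_iff\<close>)
    moreover have "link i = {5 * i, p}" using i by (auto simp: link_def p_def)
    moreover have "link (Suc i) = {5 * i + 4, r}" using i by (auto simp: link_def r_def)
    ultimately show ?thesis by simp
  qed
  have "i \<le> L \<Longrightarrow> link i \<in> A \<longleftrightarrow> (link 0 \<in> A \<longleftrightarrow> even i)" for i
  proof (induction i)
    case (Suc i)
    then show ?case using alternate[of i] by auto
  qed simp
  from this[of L] show False using L(1) by (auto simp: link_def)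
qed

subsection \<open>A partition into three linear forests\<close>

text \<open>The map permutes each block of \<open>n\<close> numbers by \<open>g\<close>: division by
  \<open>n\<close> recovers the block, and injectivity of \<open>g\<close> the residue. It provides
  the positions for \<open>linear_forestI\<close>.\<close>

lemma inj_block_permutation:
  fixes g :: "nat \<Rightarrow> nat"
  assumes "inj_on g {..<n}" "\<And>r. r < n \<Longrightarrow> g r < n" "n > 0"
  shows "inj (\<lambda>v. n * (v div n) + g (v mod n))"
proof (rule injI)
  fix v w assume eq: "n * (v div n) + g (v mod n) = n * (w div n) + g (w mod n)"
  have less: "g (x mod n) < n" for x using assms(2,3) by simp
  have "(n * (x div n) + g (x mod n)) div n = x div n" for x
    using less[of x] assms(3) by simp
  then have div: "v div n = w div n" by (metis eq)
  then have "g (v mod n) = g (w mod n)" using eq by simp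
  then have "v mod n = w mod n" using assms(1,3) by (simp add: inj_on_eq_iff)
  with div show "v = w" by (metis div_mult_mod_eq)
qed

definition spine_edges :: "nat \<Rightarrow> nat set set" where
  "spine_edges L = {{k, k + 1} | k. k + 1 < 5 * L}"

text \<open>The chords \<open>wx\<close>, \<open>ux\<close>, \<open>uv\<close>, which form the path
  \<open>w, x, u, v\<close> in each gadget.\<close>

definition zigzag_edges :: "nat \<Rightarrow> nat set set" where
  "zigzag_edges L = {{a, b} | a b. b < 5 * L \<and>
     (a mod 5 = 1 \<and> b = a + 2 \<or> a mod 5 = 0 \<and> b = a + 3 \<or> a mod 5 = 0 \<and> b = a + 4)}"

text \<open>The closing edge and the chords \<open>wv\<close>. Two of these edges share an end only
  at the last vertex, where the closing edge meets \<open>wv\<close> of the last gadget.\<close>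

definition remaining_edges :: "nat \<Rightarrow> nat set set" where
  "remaining_edges L = insert {0, 5 * L - 1} {{a, a + 3} | a. a mod 5 = 1 \<and> a + 3 < 5 * L}"

lemma linear_forest_spine: "linear_forest ({..<5 * L}, spine_edges L)"
  by (rule linear_forestI[where pos = id]) (auto simp: spine_edges_def)

lemma linear_forest_zigzag: "linear_forest ({..<5 * L}, zigzag_edges L)"
proof (rule linear_forestI)
  \<comment> \<open>residues in the order of the path 1, 3, 0, 4, 2 within a gadget\<close>
  let ?g = "\<lambda>r. [2, 0, 4, 1, 3] ! r :: nat"
  let ?pos = "\<lambda>v. 5 * (v div 5) + ?g (v mod 5)"
  have "inj ?pos"
    by (rule inj_block_permutation)
      (auto simp: inj_on_def less_Suc_eq numeral_eq_Suc)
  then show "inj_on ?pos {..<5 * L}" by (rule inj_on_subset) simp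
  fix e assume "e \<in> zigzag_edges L"
  then obtain a b where e: "e = {a, b}" and b: "b < 5 * L"
    and "a mod 5 = 1 \<and> b = a + 2 \<or> a mod 5 = 0 \<and> b = a + 3 \<or> a mod 5 = 0 \<and> b = a + 4"
    unfolding zigzag_edges_def mem_Collect_eq by (elim exE conjE)
  moreover define q where "q = a div 5"
  ultimately consider "a = 5 * q + 1" "b = 5 * q + 3" | "a = 5 * q" "b = 5 * q + 3"
    | "a = 5 * q" "b = 5 * q + 4"
    using mult_div_mod_eq[of 5 a] by fastforce
  then show "\<exists>x\<in>{..<5 * L}. \<exists>y\<in>{..<5 * L}. e = {x, y} \<and> ?pos y = Suc (?pos x)"
  proof cases
    case 1
    then show ?thesis using b e by (intro bexI[of _ a] bexI[of _ b]) auto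
  next
    case 2
    \<comment> \<open>The path runs through \<open>ux\<close> from \<open>x\<close> to
      \<open>u\<close>, so the larger number \<open>b\<close> comes first.\<close>
    then show ?thesis using b e by (intro bexI[of _ b] bexI[of _ a]) auto
  next
    case 3
    then show ?thesis using b e by (intro bexI[of _ a] bexI[of _ b]) auto
  qed
qed simp

lemma linear_forest_remaining:
  assumes "L \<ge> 1"
  shows "linear_forest ({..<5 * L}, remaining_edges L)"
proof (rule linear_forestI)
  \<comment> \<open>residues in the order 0, 2, 3, 1, 4; vertex 0 moves behind the last vertex, its neighbour\<close>
  let ?g = "\<lambda>r. [0, 3, 1, 2, 4] ! r :: nat"
  let ?h = "\<lambda>v. 5 * (v div 5) + ?g (v mod 5)"
  let ?pos = "\<lambda>v. if v = 0 then 5 * L else ?h v"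
  have inj: "inj ?h"
    by (rule inj_block_permutation)
      (auto simp: inj_on_def less_Suc_eq numeral_eq_Suc)
  \<comment> \<open>This keeps the position \<open>5 * L\<close> free for vertex 0.\<close>
  have bound: "?h v < 5 * L" if "v < 5 * L" for v
  proof -
    have "v mod 5 \<in> {0, 1, 2, 3, 4}" by auto
    then have "?g (v mod 5) < 5" by auto
    moreover have "v div 5 < L" using that by auto
    ultimately show ?thesis by linarith
  qed
  show "inj_on ?pos {..<5 * L}"
  proof (rule inj_onI)
    fix v w assume "v \<in> {..<5 * L}" "w \<in> {..<5 * L}" "?pos v = ?pos w"
    then show "v = w" using bound[of v] bound[of w] injD[OF inj, of v w] by (auto split: if_splits)
  qed
  fix e assume "e \<in> remaining_edges L"
  then consider "e = {0, 5 * L - 1}" | a where "e = {a, a + 3}" "a mod 5 = 1" "a + 3 < 5 * L"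
    unfolding remaining_edges_def by auto
  then show "\<exists>x\<in>{..<5 * L}. \<exists>y\<in>{..<5 * L}. e = {x, y} \<and> ?pos y = Suc (?pos x)"
  proof cases
    case 1
    have last: "5 * L - 1 = 5 * (L - 1) + 4" using assms by simp
    have "?h (5 * L - 1) = 5 * (L - 1) + 4" unfolding last by simp
    then have "?pos 0 = Suc (?pos (5 * L - 1))" using assms by simp
    then show ?thesis using 1 assms by (intro bexI[of _ "5 * L - 1"] bexI[of _ 0]) auto
  next
    case 2
    then obtain q where "a = 5 * q + 1" by (metis mult_div_mod_eq)
    then show ?thesis using 2 by (intro bexI[of _ a] bexI[of _ "a + 3"]) auto
  qed
qed simp

lemma edges_ring_graph_eq:
  assumes "L \<ge> 1"
  shows "edges (ring_graph L) = spine_edges L \<union> zigzag_edges L \<union> remaining_edges L"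
proof (intro equalityI subsetI)
  fix e assume "e \<in> edges (ring_graph L)"
  then obtain a b where e: "e = {a, b}" and adj: "ring_adj L a b" by (auto simp: ring_graph_def)
  then consider "b = a + 1" | "a = 0 \<and> b = 5 * L - 1" | "a mod 5 = 1 \<and> b = a + 3"
    | "a mod 5 = 1 \<and> b = a + 2 \<or> a mod 5 = 0 \<and> b = a + 3 \<or> a mod 5 = 0 \<and> b = a + 4"
    unfolding ring_adj_def by argo
  moreover have "b < 5 * L" using adj by (simp add: ring_adj_def)
  ultimately show "e \<in> spine_edges L \<union> zigzag_edges L \<union> remaining_edges L"
  proof cases
    case 1
    then have "e \<in> spine_edges L" using e \<open>b < 5 * L\<close> by (auto simp: spine_edges_def)
    then show ?thesis by simp
  next
    case 2
    then show ?thesis using e by (simp add: remaining_edges_def)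
  next
    case 3
    then have "e \<in> remaining_edges L" using e \<open>b < 5 * L\<close> by (auto simp: remaining_edges_def)
    then show ?thesis by simp
  next
    case 4
    then have "e \<in> zigzag_edges L"
      unfolding zigzag_edges_def mem_Collect_eq using e \<open>b < 5 * L\<close> by (intro exI[of _ a] exI[of _ b] conjI)
    then show ?thesis by simp
  qed
next
  fix e assume "e \<in> spine_edges L \<union> zigzag_edges L \<union> remaining_edges L"
  then have "\<exists>a b. e = {a, b} \<and> ring_adj L a b"
  proof (elim UnE)
    assume "e \<in> spine_edges L"
    then obtain a where "e = {a, a + 1}" "a + 1 < 5 * L" by (auto simp: spine_edges_def)
    then show ?thesis by (intro exI[of _ a] exI[of _ "a + 1"]) (simp add: ring_adj_def)
  next
    assume "e \<in> zigzag_edges L"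
    then obtain a b where "e = {a, b}" "b < 5 * L"
        "a mod 5 = 1 \<and> b = a + 2 \<or> a mod 5 = 0 \<and> b = a + 3 \<or> a mod 5 = 0 \<and> b = a + 4"
      unfolding zigzag_edges_def mem_Collect_eq by (elim exE conjE)
    then show ?thesis by (intro exI[of _ a] exI[of _ b]) (auto simp: ring_adj_def)
  next
    assume "e \<in> remaining_edges L"
    then consider "e = {0, 5 * L - 1}" | a where "e = {a, a + 3}" "a mod 5 = 1" "a + 3 < 5 * L"
      unfolding remaining_edges_def by auto
    then show ?thesis
    proof cases
      case 1
      then show ?thesis using assms by (intro exI[of _ 0] exI[of _ "5 * L - 1"]) (simp add: ring_adj_def)
    next
      case 2
      then show ?thesis by (intro exI[of _ a] exI[of _ "a + 3"]) (simp add: ring_adj_def)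
    qed
  qed
  then show "e \<in> edges (ring_graph L)" by (auto simp: ring_graph_def)
qed

text \<open>For \<open>L = 1\<close> the closing edge would coincide with the chord
  \<open>uv\<close>; \<open>L \<ge> 2\<close> separates them.\<close>

lemma disjoint_edge_classes:
  assumes "L \<ge> 2"
  shows "spine_edges L \<inter> zigzag_edges L = {}" "spine_edges L \<inter> remaining_edges L = {}"
    "zigzag_edges L \<inter> remaining_edges L = {}"
  using assms
  by (auto simp: spine_edges_def zigzag_edges_def remaining_edges_def doubleton_eq_iff)

lemma linear_arboricity_ring_graph:
  assumes L: "odd L" "L \<ge> 2"
  shows "linear_arboricity (ring_graph L) = 3"
  unfolding linear_arboricity_def
proof (rule Least_equality)
  let ?E = "edges (ring_graph L)" and ?P = "{spine_edges L, zigzag_edges L, remaining_edges L}"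
  have L1: "L \<ge> 1" using L by simp
  \<comment> \<open>One edge from each class: nonempty disjoint classes are distinct, so the
    partition has exactly three parts.\<close>
  have "{0, 1} \<in> spine_edges L" using L by (auto simp: spine_edges_def)
  moreover have "{0, 3} \<in> zigzag_edges L" using L by (force simp: zigzag_edges_def)
  moreover have "{0, 5 * L - 1} \<in> remaining_edges L" by (simp add: remaining_edges_def)
  ultimately have ne: "spine_edges L \<noteq> {}" "zigzag_edges L \<noteq> {}" "remaining_edges L \<noteq> {}" by blast+
  note disj = disjoint_edge_classes[OF L(2)]
  have neq: "spine_edges L \<noteq> zigzag_edges L" "spine_edges L \<noteq> remaining_edges L"
    "zigzag_edges L \<noteq> remaining_edges L"
    using disj ne by auto
  have "partition_on ?E ?P"
  proof (rule partition_onI)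
    show "\<Union>?P = ?E" using edges_ring_graph_eq[OF L1] by auto
    show "disjnt p q" if "p \<in> ?P" "q \<in> ?P" "p \<noteq> q" for p q
      using that disj by (auto simp: disjnt_def)
  qed (use ne in auto)
  moreover have "card ?P = 3" using neq by simp
  moreover have "\<forall>F\<in>?P. linear_forest (verts (ring_graph L), F)"
    using linear_forest_spine linear_forest_zigzag linear_forest_remaining[OF L1] by simp
  ultimately show "\<exists>P. partition_on ?E P \<and> card P = 3 \<and>
      (\<forall>F\<in>P. linear_forest (verts (ring_graph L), F))"
    by blast
  fix k assume "\<exists>P. partition_on ?E P \<and> card P = k \<and> (\<forall>F\<in>P. linear_forest (verts (ring_graph L), F))"
  then obtain P where P: "partition_on ?E P" "card P = k"
      "\<And>F. F \<in> P \<Longrightarrow> linear_forest (verts (ring_graph L), F)"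
    by blast
  have UP: "\<Union>P = ?E" using P(1) by (simp add: partition_on_def)
  show "3 \<le> k"
  proof (rule ccontr)
    assume "\<not> 3 \<le> k"
    have "?E \<subseteq> Pow {..<5 * L}" using simple_graph_ring_graph[of L] by (auto simp: simple_graph_def)
    then have "finite ?E" by (rule finite_subset) simp
    then have finP: "finite P" using P(1) by (rule finite_elements)
    \<comment> \<open>This excludes the empty partition. A partition with a single part
      \<open>A\<close> is treated below as the cover by \<open>A\<close> and
      \<open>B = A\<close>.\<close>
    have "?E \<noteq> {}" using edges_ring_graph_eq[OF L1] ne by auto
    then obtain A where A: "A \<in> P" using UP by auto
    have "card (P - {A}) \<le> 1" using A finP P(2) \<open>\<not> 3 \<le> k\<close> by simp
    then consider "P - {A} = {}" | B where "P - {A} = {B}"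
      using finP by (metis One_nat_def card_0_eq card_1_singletonE finite_Diff le_Suc_eq le_zero_eq)
    then obtain B where "B \<in> P" "P \<subseteq> {A, B}" using A by cases blast+
    then show False
      using ring_graph_not_two_linear_forests[OF L P(3)[OF A] P(3)[OF \<open>B \<in> P\<close>]] UP by blast
  qed
qed

theorem theorem5p6:
  fixes m :: nat
  assumes "m \<ge> 1"
  shows "\<exists>G :: nat graph.
    simple_graph G \<and> k_connected 2 G \<and> pseudo_outerplanar G \<and>
    card (verts G) = 10 * m + 5 \<and>
    max_degree G = 4 \<and>
    int (linear_arboricity G) = \<lceil>real (max_degree G) / 2\<rceil> + 1 \<and>
    linear_arboricity G = 3"
proof -
  \<comment> \<open>An odd number of gadgets with five vertices each gives order
    \<open>10 * m + 5\<close>, and \<open>m \<ge> 1\<close> ensures at least two gadgets.\<close>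
  let ?G = "ring_graph (2 * m + 1)"
  have "max_degree ?G = 4" by (rule max_degree_ring_graph) simp
  moreover have "linear_arboricity ?G = 3"
    by (rule linear_arboricity_ring_graph) (use assms in auto)
  ultimately show ?thesis
    using simple_graph_ring_graph two_connected_ring_graph[of "2 * m + 1"]
      pseudo_outerplanar_ring_graph[of "2 * m + 1"]
    by (intro exI[of _ ?G]) simp
qed

end
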